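(* Let $\Gamma(\mathbb{Z}_n)$ be the comaximal graph of $\mathbb{Z}_n$. Then the following hold. (i) If $n=p$ is a prime, then the independent domination polynomial of $\Gamma(\mathbb{Z}_n)$ is $D_i(\Gamma(\mathbb{Z}_n),x)=px$. (ii) If $n=pq$, where $p<q$ are primes, then $$D_i(\Gamma(\mathbb{Z}_n),x)=(pq-p-q+1)x+x^p+x^q.$$ (iii) If $n=pqr$, where $p<q<r$ are primes, then $$D_i(\Gamma(\mathbb{Z}_n),x)=\phi(n)x+x^{p+q+r-2}+x^{pq}+x^{pr}+x^{qr}.$$
   Context: For a commutative ring $R$ with identity $1\ne 0$, the comaximal graph $\Gamma(R)$ is the simple graph with vertex set $R$ in which two distinct vertices $a,b$ are adjacent if and only if $aR+bR=R$. $\phi$ is Euler's totient function. A set $S\subseteq V(G)$ is dominating if every vertex of $V(G)\setminus S$ is adjacent to at least one vertex of $S$; it is independent if its elements are pairwise non-adjacent; it is an independent dominating set if it is both. The independent domination polynomial is $D_i(G,x)=\sum_k d_i(G,k)x^k$, where $d_i(G,k)$ is the number of independent dominating sets of $G$ of cardinality $k$. *)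

theory Defs
  imports
    "HOL-Number_Theory.Number_Theory"
    "HOL-Computational_Algebra.Polynomial"
    "Graph_Theory.Pair_Digraph"
begin

(* A finite simple graph is a symmetric loop-free digraph without parallel arcs: locale pair_graph. *)

definition independent_set :: "'a pair_pre_digraph \<Rightarrow> 'a set \<Rightarrow> bool" where
  "independent_set G S \<longleftrightarrow>
     S \<subseteq> pverts G \<and> (\<forall>u\<in>S. \<forall>v\<in>S. u \<noteq> v \<longrightarrow> (u, v) \<notin> parcs G)"

definition dominating_set :: "'a pair_pre_digraph \<Rightarrow> 'a set \<Rightarrow> bool" where
  "dominating_set G S \<longleftrightarrow>
     S \<subseteq> pverts G \<and> (\<forall>v \<in> pverts G - S. \<exists>u\<in>S. (v, u) \<in> parcs G)"

definition independent_dominating_set :: "'a pair_pre_digraph \<Rightarrow> 'a set \<Rightarrow> bool" where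
  "independent_dominating_set G S \<longleftrightarrow> independent_set G S \<and> dominating_set G S"

definition num_independent_dominating_sets :: "'a pair_pre_digraph \<Rightarrow> nat \<Rightarrow> nat" where
  "num_independent_dominating_sets G k =
     card {S. independent_dominating_set G S \<and> card S = k}"

definition independent_domination_poly :: "'a pair_pre_digraph \<Rightarrow> int poly" where
  "independent_domination_poly G =
     (\<Sum>k\<le>card (pverts G). monom (int (num_independent_dominating_sets G k)) k)"

(* The library ideal PIdl a is {x a | x in R}; this is aR, as R is meant to be commutative. *)
definition comaximal_graph :: "('a, 'b) ring_scheme \<Rightarrow> 'a pair_pre_digraph" where
  "comaximal_graph R =
     \<lparr> pverts = carrier R,
       parcs = {(a, b). a \<in> carrier R \<and> b \<in> carrier R \<and> a \<noteq> b \<and>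
                  PIdl\<^bsub>R\<^esub> a <+>\<^bsub>R\<^esub> PIdl\<^bsub>R\<^esub> b = carrier R} \<rparr>"

lemma pair_graph_comaximal_graph:
  fixes R (structure)
  assumes "cring R" "finite (carrier R)"
  shows "pair_graph (comaximal_graph R)"
proof -
  interpret cring R by fact
  have comm: "PIdl a <+>\<^bsub>R\<^esub> PIdl b = PIdl b <+>\<^bsub>R\<^esub> PIdl a"
    if ab: "a \<in> carrier R" "b \<in> carrier R" for a b
  proof (rule set_add_comm)
    show "PIdl a \<subseteq> carrier R" "PIdl b \<subseteq> carrier R"
      using ab unfolding cgenideal_def by blast+
  qed
  have sub: "parcs (comaximal_graph R) \<subseteq> carrier R \<times> carrier R"
    by (auto simp: comaximal_graph_def)
  have "finite (parcs (comaximal_graph R))"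
    using assms(2) by (intro finite_subset[OF sub] finite_cartesian_product)
  moreover have "sym (parcs (comaximal_graph R))"
  proof (rule symI)
    fix a b assume "(a, b) \<in> parcs (comaximal_graph R)"
    then show "(b, a) \<in> parcs (comaximal_graph R)"
      using comm[of b a] by (auto simp: comaximal_graph_def)
  qed
  moreover have "\<And>e. e \<in> parcs (comaximal_graph R) \<Longrightarrow> fst e \<noteq> snd e"
    by (auto simp: comaximal_graph_def)
  moreover have "pverts (comaximal_graph R) = carrier R"
    by (simp add: comaximal_graph_def)
  ultimately show ?thesis
    using assms(2) sub by unfold_locales (auto simp: symmetric_def)
qed

end

theory Submission
  imports Defs
begin

text \<open>
  By Bezout, distinct \<open>a\<close> and \<open>b\<close> are adjacent iff no prime divisor of \<open>n\<close> divides both. A unit is adjacent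
  to every other vertex, so each of the \<open>\<phi>(n)\<close> units is an independent dominating set on its own, and
  every other independent dominating set is a maximal family of residues any two of which share a
  prime divisor of \<open>n\<close>. If \<open>n\<close> is a product of at most three distinct primes, such a family consists
  of all multiples of one prime or, for three primes, of all residues divisible by at least two
  of them.
\<close>

section \<open>From coefficients to a sum over sets\<close>

text \<open>Grouping the sets by cardinality turns each coefficient into a number of equal terms
  \<open>monom 1 k\<close>. In this form a classification of the sets together with their sizes
  yields the polynomial at once.\<close>

lemma independent_domination_poly_eq_sum:
  assumes "finite (pverts G)"
  shows "independent_domination_poly G =
    (\<Sum>S | independent_dominating_set G S. monom 1 (card S))"
proof -
  let ?A = "{S. independent_dominating_set G S}"
  have sub: "?A \<subseteq> Pow (pverts G)"
    by (auto simp: independent_dominating_set_def independent_set_def)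
  then have fin: "finite ?A"
    using assms finite_subset by blast
  have "card ` ?A \<subseteq> {..card (pverts G)}"
    using sub assms by (auto intro!: card_mono)
  then have "(\<Sum>S\<in>?A. monom 1 (card S)) =
      (\<Sum>k\<le>card (pverts G). \<Sum>S | S \<in> ?A \<and> card S = k. monom (1::int) (card S))"
    using fin by (intro sum.group[symmetric]) auto
  also have "\<dots> = (\<Sum>k\<le>card (pverts G). monom (int (num_independent_dominating_sets G k)) k)"
  proof (rule sum.cong)
    fix k
    have "(\<Sum>S | S \<in> ?A \<and> card S = k. monom (1::int) (card S)) =
        (\<Sum>S | S \<in> ?A \<and> card S = k. monom 1 k)"
      by (rule sum.cong) auto
    then show "(\<Sum>S | S \<in> ?A \<and> card S = k. monom (1::int) (card S)) =
        monom (int (num_independent_dominating_sets G k)) k"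
      by (simp add: num_independent_dominating_sets_def of_nat_monom mult_monom)
  qed simp
  finally show ?thesis
    by (simp add: independent_domination_poly_def)
qed

section \<open>Adjacency in the comaximal graph of the integers modulo m\<close>

lemma pverts_comaximal_residue_ring:
  "pverts (comaximal_graph (residue_ring m)) = {0..<m}"
  by (auto simp: comaximal_graph_def residue_ring_def)

lemma cgenideal_residue_ring:
  assumes "m > 1"
  shows "PIdl\<^bsub>residue_ring m\<^esub> a = range (\<lambda>x. x * a mod m)"
proof (intro equalityI subsetI)
  fix y assume "y \<in> range (\<lambda>x. x * a mod m)"
  then obtain x where "y = x * a mod m" by blast
  \<comment> \<open>The ideal takes its multipliers from the carrier; reducing \<open>x\<close>
    modulo \<open>m\<close> moves it there without changing the product modulo
    \<open>m\<close>.\<close>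
  then have "y = (x mod m) * a mod m" "x mod m \<in> {0..m - 1}"
    using assms by (auto simp: mod_mult_left_eq)
  then show "y \<in> PIdl\<^bsub>residue_ring m\<^esub> a"
    unfolding cgenideal_def by (auto simp: residue_ring_def)
qed (auto simp: cgenideal_def residue_ring_def)

text \<open>If 1 lies in the sum of the two ideals, some combination of \<open>a\<close> and
  \<open>b\<close> is congruent to 1, hence coprime to \<open>m\<close>, and \<open>gcd a b\<close>
  divides it. Conversely, Bezout writes 1 as a combination of \<open>a\<close>, \<open>b\<close> and
  \<open>m\<close>, and multiplying by \<open>z\<close> puts every residue \<open>z\<close> into the
  sum.\<close>

lemma parcs_comaximal_residue_ring:
  assumes m: "m > 1"
  shows "(a, b) \<in> parcs (comaximal_graph (residue_ring m)) \<longleftrightarrow>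
    a \<in> {0..<m} \<and> b \<in> {0..<m} \<and> a \<noteq> b \<and> coprime (gcd a b) m"
proof -
  let ?I = "PIdl\<^bsub>residue_ring m\<^esub> a <+>\<^bsub>residue_ring m\<^esub> PIdl\<^bsub>residue_ring m\<^esub> b"
  have I: "?I = {(x * a + y * b) mod m | x y. True}"
    unfolding set_add_def' cgenideal_residue_ring[OF m]
    by (auto simp: residue_ring_def mod_add_eq)
  have "?I = {0..<m} \<longleftrightarrow> coprime (gcd a b) m"
  proof
    assume "?I = {0..<m}"
    then have "1 \<in> ?I" using m by auto
    then obtain x y where "(x * a + y * b) mod m = 1" unfolding I by auto
    then have "[x * a + y * b = 1] (mod m)"
      using m by (simp add: cong_def)
    then have "coprime (x * a + y * b) m"
      by (metis cong_imp_coprime cong_sym coprime_1_left)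
    then show "coprime (gcd a b) m"
      by (rule coprime_divisors[rotated 2]) auto
  next
    assume "coprime (gcd a b) m"
    then obtain u v where "u * gcd a b + v * m = 1"
      by (metis bezout_int coprime_iff_gcd_eq_1)
    moreover obtain s t where "s * a + t * b = gcd a b"
      using bezout_int by blast
    \<comment> \<open>Two Bezout identities are nested: one for \<open>gcd a b\<close> and
      \<open>m\<close>, one for \<open>a\<close> and \<open>b\<close>.\<close>
    ultimately have e: "1 = u * (s * a + t * b) + v * m" by simp
    have "z \<in> ?I" if "z \<in> {0..<m}" for z
    proof -
      have "z = z * (u * (s * a + t * b) + v * m)"
        using e by simp
      also have "\<dots> = (z * u * s * a + z * u * t * b) + z * v * m"
        by (simp add: algebra_simps)
      finally have "z mod m = (z * u * s * a + z * u * t * b) mod m"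
        by (metis mod_mult_self1)
      then show ?thesis
        using that unfolding I by auto
    qed
    then show "?I = {0..<m}"
      using m by (auto simp: I)
  qed
  moreover have "carrier (residue_ring m) = {0..<m}"
    by (auto simp: residue_ring_def)
  ultimately show ?thesis
    by (simp add: comaximal_graph_def)
qed

section \<open>Independent dominating sets as maximal intersecting families\<close>

text \<open>A residue stands for the set of prime divisors of \<open>m\<close> that divide it, and
  two residues intersect if these sets meet. In the fixed-point equation the inclusion from left to
  right says that any two members intersect, and the case \<open>x = y\<close> excludes units; the
  converse inclusion is maximality.\<close>

definition maximal_intersecting :: "int \<Rightarrow> int set \<Rightarrow> bool" where
  "maximal_intersecting m S \<longleftrightarrow> S = {x \<in> {0..<m}. \<forall>y\<in>S. \<not> coprime (gcd x y) m}"

text \<open>A unit is adjacent to every other vertex, so an independent set containing one is a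
  singleton. For a set without units, independence and domination are the two inclusions of the
  fixed-point equation.\<close>

lemma independent_dominating_set_comaximal_iff:
  assumes m: "m > 1"
  shows "independent_dominating_set (comaximal_graph (residue_ring m)) S \<longleftrightarrow>
    (\<exists>u\<in>{0..<m}. coprime u m \<and> S = {u}) \<or> maximal_intersecting m S"
    (is "?ids S \<longleftrightarrow> _")
proof -
  define C where "C = (\<lambda>x y. coprime (gcd x y) m)"
  have unit: "C u y" "C y u" if "coprime u m" for u y
    unfolding C_def by (rule coprime_divisors[OF _ dvd_refl that]; simp)+
  have parcs: "(a, b) \<in> parcs (comaximal_graph (residue_ring m)) \<longleftrightarrow>
      a \<in> {0..<m} \<and> b \<in> {0..<m} \<and> a \<noteq> b \<and> C a b" for a b
    unfolding C_def by (rule parcs_comaximal_residue_ring[OF m])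
  have ids: "?ids S \<longleftrightarrow> S \<subseteq> {0..<m} \<and> (\<forall>x\<in>S. \<forall>y\<in>S. x \<noteq> y \<longrightarrow> \<not> C x y) \<and>
      (\<forall>x\<in>{0..<m} - S. \<exists>y\<in>S. C x y)"
    unfolding independent_dominating_set_def independent_set_def dominating_set_def
      pverts_comaximal_residue_ring parcs
    by blast
  have max: "maximal_intersecting m S \<longleftrightarrow> S = {x \<in> {0..<m}. \<forall>y\<in>S. \<not> C x y}"
    by (simp add: maximal_intersecting_def C_def)
  show ?thesis
  proof
    assume L: "?ids S"
    show "(\<exists>u\<in>{0..<m}. coprime u m \<and> S = {u}) \<or> maximal_intersecting m S"
    proof (cases "\<exists>u\<in>S. coprime u m")
      case True
      then show ?thesis using L unit unfolding ids by blast
    next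
      case False
      \<comment> \<open>Independence concerns distinct vertices only; the absence of units supplies
        the diagonal pairs.\<close>
      then have "\<not> C x x" if "x \<in> S" for x
        using that by (auto simp: C_def)
      then have "\<not> C x y" if "x \<in> S" "y \<in> S" for x y
        using that L unfolding ids by metis
      then have "S = {x \<in> {0..<m}. \<forall>y\<in>S. \<not> C x y}"
        using L unfolding ids by (intro equalityI subsetI CollectI conjI ballI) blast+
      then show ?thesis
        unfolding max by (rule disjI2)
    qed
  next
    assume "(\<exists>u\<in>{0..<m}. coprime u m \<and> S = {u}) \<or> maximal_intersecting m S"
    then show "?ids S"
    proof
      assume "\<exists>u\<in>{0..<m}. coprime u m \<and> S = {u}"
      then show ?thesis using unit unfolding ids by auto
    next
      assume "maximal_intersecting m S"
      then have "x \<in> S \<longleftrightarrow> x \<in> {0..<m} \<and> (\<forall>y\<in>S. \<not> C x y)" for x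
        unfolding max by blast
      then show ?thesis unfolding ids by blast
    qed
  qed
qed

text \<open>\<open>totatives n\<close> is taken from 1 to \<open>n\<close>, the residues from 0 to
  \<open>n - 1\<close>. For \<open>n > 1\<close> neither 0 nor \<open>n\<close> is coprime to
  \<open>n\<close>, so the two sets agree.\<close>

lemma card_units_eq_totient:
  assumes "n > 1"
  shows "card {u \<in> {0..<int n}. coprime u (int n)} = totient n"
proof -
  have "{u \<in> {0..<int n}. coprime u (int n)} = int ` totatives n"
  proof (intro equalityI subsetI)
    fix u assume u: "u \<in> {u \<in> {0..<int n}. coprime u (int n)}"
    then obtain k where k: "u = int k" using nonneg_int_cases by auto
    moreover have "k \<noteq> 0" using u k assms by (auto intro!: Nat.gr0I)
    ultimately show "u \<in> int ` totatives n"
      using u by (auto simp: totatives_def)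
  next
    fix u assume "u \<in> int ` totatives n"
    then show "u \<in> {u \<in> {0..<int n}. coprime u (int n)}"
      using assms totatives_less[of _ n] by (auto simp: totatives_def)
  qed
  then show ?thesis
    by (simp add: totient_def card_image)
qed

text \<open>The singletons of units give the linear term. They are disjoint from the maximal
  intersecting families, which contain no unit, so it remains to list these families and their
  sizes.\<close>

lemma independent_domination_poly_comaximal:
  assumes n: "n > 1"
  shows "independent_domination_poly (comaximal_graph (residue_ring (int n))) =
    monom (int (totient n)) 1 + (\<Sum>S | maximal_intersecting (int n) S. monom 1 (card S))"
proof -
  define U where "U = {u \<in> {0..<int n}. coprime u (int n)}"
  define M where "M = {S. maximal_intersecting (int n) S}"
  have ids: "{S. independent_dominating_set (comaximal_graph (residue_ring (int n))) S} =
      (\<lambda>u. {u}) ` U \<union> M"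
    using n by (auto simp: U_def M_def independent_dominating_set_comaximal_iff)
  have "M \<subseteq> Pow {0..<int n}"
    by (auto simp: M_def maximal_intersecting_def)
  then have fin: "finite M"
    by (rule finite_subset) simp
  have "finite {0..<int n}" by simp
  then have finU: "finite U"
    by (rule rev_finite_subset) (auto simp: U_def)
  have "(\<lambda>u. {u}) ` U \<inter> M = {}"
  proof -
    have "\<not> maximal_intersecting (int n) {u}" if "u \<in> U" for u
    proof
      assume "maximal_intersecting (int n) {u}"
      then have "\<not> coprime (gcd u u) (int n)"
        unfolding maximal_intersecting_def by blast
      then show False using that by (simp add: U_def)
    qed
    then show ?thesis by (auto simp: M_def)
  qed
  moreover have "(\<Sum>S\<in>(\<lambda>u. {u}) ` U. monom (1::int) (card S)) = monom (int (totient n)) 1"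
    using card_units_eq_totient[OF n]
    by (simp add: sum.reindex U_def of_nat_monom mult_monom)
  ultimately show ?thesis
    using fin finU
    by (simp add: independent_domination_poly_eq_sum pverts_comaximal_residue_ring ids
        sum.union_disjoint flip: M_def)
qed

section \<open>Counting multiples\<close>

lemma card_multiples:
  assumes "d > 0"
  shows "card {x \<in> {0..<int (d * e)}. int d dvd x} = e"
proof -
  have "{x \<in> {0..<int (d * e)}. int d dvd x} = (\<lambda>k. int d * int k) ` {..<e}"
  proof (intro equalityI subsetI)
    fix x assume x: "x \<in> {x \<in> {0..<int (d * e)}. int d dvd x}"
    then obtain k where k: "x = int d * k" by (auto elim: dvdE)
    then have "0 \<le> int d * k" "int d * k < int d * int e"
      using x by simp_all
    then have "k \<ge> 0" "k < int e"
      using assms by (simp_all add: zero_le_mult_iff)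
    then show "x \<in> (\<lambda>k. int d * int k) ` {..<e}"
      using k by (intro image_eqI[of _ _ "nat k"]) auto
  next
    fix x assume "x \<in> (\<lambda>k. int d * int k) ` {..<e}"
    then obtain k where "x = int (d * k)" "k < e" by auto
    then show "x \<in> {x \<in> {0..<int (d * e)}. int d dvd x}"
      using assms by (auto simp flip: of_nat_mult)
  qed
  moreover have "inj_on (\<lambda>k. int d * int k) {..<e}"
    using assms by (auto intro!: inj_onI)
  ultimately show ?thesis
    by (simp add: card_image)
qed

section \<open>Maximal intersecting families for one, two and three primes\<close>

lemma not_coprime_gcd_prime_iff:
  assumes "prime (p :: int)"
  shows "\<not> coprime (gcd x y) p \<longleftrightarrow> p dvd x \<and> p dvd y"
proof -
  have "coprime (gcd x y) p \<longleftrightarrow> \<not> p dvd gcd x y"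
    using assms by (metis coprime_commute not_prime_unit coprime_absorb_left prime_imp_coprime)
  then show ?thesis by simp
qed

lemma maximal_intersecting_prime:
  assumes "prime (p :: int)"
  shows "{S. maximal_intersecting p S} = {{0}}"
proof -
  have z: "x = 0" if "x \<in> {0..<p}" "p dvd x" for x
    using that zdvd_not_zless[of x p] by force
  have p: "p > 0" using assms by (rule prime_gt_0_int)
  have "maximal_intersecting p S \<longleftrightarrow> S = {0}" for S
  proof
    assume S: "maximal_intersecting p S"
    then have "S = {x \<in> {0..<p}. \<forall>y\<in>S. p dvd x \<and> p dvd y}"
      unfolding maximal_intersecting_def not_coprime_gcd_prime_iff[OF assms] .
    \<comment> \<open>For empty \<open>S\<close> the right-hand side would be all of
      \<open>{0..<p}\<close>, which contains 0.\<close>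
    moreover from this have "S \<noteq> {}" using p by force
    ultimately show "S = {0}" using z by blast
  next
    assume "S = {0}"
    then show "maximal_intersecting p S"
      unfolding maximal_intersecting_def not_coprime_gcd_prime_iff[OF assms]
      using z p by auto
  qed
  then show ?thesis by auto
qed

text \<open>Shows that a star, the family of all multiples of one prime, is maximal. The witness
  \<open>a\<close> is that prime itself: no other prime of the modulus divides it, so whatever
  intersects it belongs to the star.\<close>

lemma star_eq_intersecting:
  assumes "a \<in> V" "P a" "\<And>x y. P x \<Longrightarrow> P y \<Longrightarrow> R x y" "\<And>x. R x a \<Longrightarrow> P x"
  shows "{x \<in> V. P x} = {x \<in> V. \<forall>y\<in>{x \<in> V. P x}. R x y}"
  using assms by blast

text \<open>If both primes divided every member, then \<open>p\<close> would intersect all of them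
  and belong to \<open>S\<close>, although \<open>q\<close> does not divide it. So some member is
  divisible by exactly one prime; all members must share that prime with it, and maximality adds all
  other multiples.\<close>

lemma maximal_intersecting_two_primes:
  assumes pq: "prime (p :: int)" "prime q" "p \<noteq> q"
  defines "V \<equiv> {0..<p * q}"
  shows "{S. maximal_intersecting (p * q) S} = {{x \<in> V. p dvd x}, {x \<in> V. q dvd x}}"
proof -
  \<comment> \<open>Coprimality to a product splits into coprimality to each factor, so intersecting
    becomes a disjunction over the primes.\<close>
  have nc: "\<not> coprime (gcd x y) (p * q) \<longleftrightarrow> p dvd x \<and> p dvd y \<or> q dvd x \<and> q dvd y" for x y
    using pq by (metis coprime_mult_right_iff not_coprime_gcd_prime_iff)
  have gt: "p > 1" "q > 1" using pq prime_gt_1_int by auto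
  have V: "p \<in> V" "q \<in> V" using gt by (auto simp: V_def)
  have nd: "\<not> p dvd q" "\<not> q dvd p"
    using pq primes_dvd_imp_eq by auto
  have "maximal_intersecting (p * q) S \<longleftrightarrow> S = {x \<in> V. p dvd x} \<or> S = {x \<in> V. q dvd x}" for S
  proof
    assume "maximal_intersecting (p * q) S"
    then have S: "S = {x \<in> V. \<forall>y\<in>S. p dvd x \<and> p dvd y \<or> q dvd x \<and> q dvd y}"
      unfolding maximal_intersecting_def nc V_def .
    show "S = {x \<in> V. p dvd x} \<or> S = {x \<in> V. q dvd x}"
      using S V nd by blast
  next
    assume "S = {x \<in> V. p dvd x} \<or> S = {x \<in> V. q dvd x}"
    then show "maximal_intersecting (p * q) S"
      unfolding maximal_intersecting_def nc V_def[symmetric]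
    proof (elim disjE ssubst)
      show "{x \<in> V. p dvd x} = {x \<in> V. \<forall>y\<in>{x \<in> V. p dvd x}. p dvd x \<and> p dvd y \<or> q dvd x \<and> q dvd y}"
        by (rule star_eq_intersecting[OF V(1)]) (use nd in auto)
      show "{x \<in> V. q dvd x} = {x \<in> V. \<forall>y\<in>{x \<in> V. q dvd x}. p dvd x \<and> p dvd y \<or> q dvd x \<and> q dvd y}"
        by (rule star_eq_intersecting[OF V(2)]) (use nd in auto)
    qed
  qed
  then show ?thesis by auto
qed

text \<open>A member divisible by only one prime forces the star of that prime. Otherwise every
  member is divisible by at least two of the three primes, and any two such residues share
  one.\<close>

lemma maximal_intersecting_three_primes:
  assumes pqr: "prime (p :: int)" "prime q" "prime r" "p \<noteq> q" "p \<noteq> r" "q \<noteq> r"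
  defines "V \<equiv> {0..<p * q * r}"
  shows "{S. maximal_intersecting (p * q * r) S} =
    {{x \<in> V. p dvd x}, {x \<in> V. q dvd x}, {x \<in> V. r dvd x},
     {x \<in> V. p dvd x \<and> q dvd x \<or> p dvd x \<and> r dvd x \<or> q dvd x \<and> r dvd x}}"
proof -
  have nc: "\<not> coprime (gcd x y) (p * q * r) \<longleftrightarrow>
      p dvd x \<and> p dvd y \<or> q dvd x \<and> q dvd y \<or> r dvd x \<and> r dvd y" for x y
    using pqr by (metis coprime_mult_right_iff not_coprime_gcd_prime_iff)
  have gt: "p > 1" "q > 1" "r > 1" using pqr prime_gt_1_int by auto
  have lt: "a < a * b \<and> a * b < a * b * c" if "a > 1" "b > 1" "c > 1" for a b c :: int
    using that by (auto simp: less_1_mult)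
  \<comment> \<open>The primes are the witnesses for the stars, their pairwise products those for
    the fourth family.\<close>
  have V: "p \<in> V" "q \<in> V" "r \<in> V" "p * q \<in> V" "p * r \<in> V" "q * r \<in> V"
    using lt[of p q r] lt[of q p r] lt[of r p q] lt[of p r q] lt[of q r p] gt
      less_1_mult[OF gt(1,2)] less_1_mult[OF gt(1,3)] less_1_mult[OF gt(2,3)]
    by (auto simp: V_def algebra_simps)
  have nd: "\<not> p dvd q" "\<not> p dvd r" "\<not> q dvd p" "\<not> q dvd r" "\<not> r dvd p" "\<not> r dvd q"
    using pqr primes_dvd_imp_eq by auto
  then have ndm: "\<not> p dvd q * r" "\<not> q dvd p * r" "\<not> r dvd p * q"
    using pqr by (auto simp: prime_dvd_mult_iff)
  have "maximal_intersecting (p * q * r) S \<longleftrightarrow>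
      S = {x \<in> V. p dvd x} \<or> S = {x \<in> V. q dvd x} \<or> S = {x \<in> V. r dvd x} \<or>
      S = {x \<in> V. p dvd x \<and> q dvd x \<or> p dvd x \<and> r dvd x \<or> q dvd x \<and> r dvd x}"
      (is "_ \<longleftrightarrow> ?R") for S
  proof
    assume "maximal_intersecting (p * q * r) S"
    then have S: "S = {x \<in> V. \<forall>y\<in>S. p dvd x \<and> p dvd y \<or> q dvd x \<and> q dvd y \<or> r dvd x \<and> r dvd y}"
      unfolding maximal_intersecting_def nc V_def .
    \<comment> \<open>In each of the first three cases \<open>y\<close> misses two primes, so every
      member must share the third with it.\<close>
    consider y where "y \<in> S" "\<not> q dvd y" "\<not> r dvd y" | y where "y \<in> S" "\<not> p dvd y" "\<not> r dvd y"
      | y where "y \<in> S" "\<not> p dvd y" "\<not> q dvd y"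
      | "\<forall>x\<in>S. p dvd x \<and> q dvd x \<or> p dvd x \<and> r dvd x \<or> q dvd x \<and> r dvd x"
      by blast
    then show ?R
    proof cases
      case 1
      then have "\<forall>x\<in>S. p dvd x" using S by blast
      then have "S = {x \<in> V. p dvd x}" using S by blast
      then show ?thesis by simp
    next
      case 2
      then have "\<forall>x\<in>S. q dvd x" using S by blast
      then have "S = {x \<in> V. q dvd x}" using S by blast
      then show ?thesis by simp
    next
      case 3
      then have "\<forall>x\<in>S. r dvd x" using S by blast
      then have "S = {x \<in> V. r dvd x}" using S by blast
      then show ?thesis by simp
    next
      case 4
      \<comment> \<open>Two of three primes always overlap with two of three, so maximality puts
        every residue divisible by two of the primes into \<open>S\<close>.\<close>
      then have "S = {x \<in> V. p dvd x \<and> q dvd x \<or> p dvd x \<and> r dvd x \<or> q dvd x \<and> r dvd x}"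
        using S by blast
      then show ?thesis by simp
    qed
  next
    assume ?R
    then consider "S = {x \<in> V. p dvd x}" | "S = {x \<in> V. q dvd x}" | "S = {x \<in> V. r dvd x}"
      | "S = {x \<in> V. p dvd x \<and> q dvd x \<or> p dvd x \<and> r dvd x \<or> q dvd x \<and> r dvd x}"
      by blast
    then show "maximal_intersecting (p * q * r) S"
      unfolding maximal_intersecting_def nc V_def[symmetric]
    proof cases
      case 1
      show "S = {x \<in> V. \<forall>y\<in>S. p dvd x \<and> p dvd y \<or> q dvd x \<and> q dvd y \<or> r dvd x \<and> r dvd y}"
        unfolding 1 by (rule star_eq_intersecting[OF V(1)]) (use nd in auto)
    next
      case 2
      show "S = {x \<in> V. \<forall>y\<in>S. p dvd x \<and> p dvd y \<or> q dvd x \<and> q dvd y \<or> r dvd x \<and> r dvd y}"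
        unfolding 2 by (rule star_eq_intersecting[OF V(2)]) (use nd in auto)
    next
      case 3
      show "S = {x \<in> V. \<forall>y\<in>S. p dvd x \<and> p dvd y \<or> q dvd x \<and> q dvd y \<or> r dvd x \<and> r dvd y}"
        unfolding 3 by (rule star_eq_intersecting[OF V(3)]) (use nd in auto)
    next
      case 4
      \<comment> \<open>These three members test maximality: a residue divisible by \<open>p\<close>
        alone fails to intersect \<open>q * r\<close>, and similarly for the other primes.\<close>
      then have "p * q \<in> S" "p * r \<in> S" "q * r \<in> S" using V by auto
      then have "x \<in> S" if "x \<in> V"
          "\<forall>y\<in>S. p dvd x \<and> p dvd y \<or> q dvd x \<and> q dvd y \<or> r dvd x \<and> r dvd y" for x
        using that ndm 4 by blast
      moreover have "S \<subseteq> V" using 4 by blast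
      moreover have "\<forall>x\<in>S. \<forall>y\<in>S. p dvd x \<and> p dvd y \<or> q dvd x \<and> q dvd y \<or> r dvd x \<and> r dvd y"
        using 4 by blast
      ultimately show "S = {x \<in> V. \<forall>y\<in>S. p dvd x \<and> p dvd y \<or> q dvd x \<and> q dvd y \<or> r dvd x \<and> r dvd y}"
        by blast
    qed
  qed
  then show ?thesis by auto
qed

section \<open>The three polynomials\<close>

lemma independent_domination_poly_comaximal_prime:
  assumes "prime p"
  shows "independent_domination_poly (comaximal_graph (residue_ring (int p))) = monom (int p) 1"
proof -
  have "p > 1" using assms by (rule prime_gt_1_nat)
  \<comment> \<open>The \<open>p - 1\<close> units and the family \<open>{0}\<close> are all sets of
    size 1 and together give the coefficient \<open>p\<close>.\<close>
  then show ?thesis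
    using assms
    by (simp add: independent_domination_poly_comaximal maximal_intersecting_prime
        totient_prime add_monom)
qed

lemma independent_domination_poly_comaximal_two_primes:
  assumes pq: "prime p" "prime q" "p < q"
  shows "independent_domination_poly (comaximal_graph (residue_ring (int (p * q)))) =
    monom (int p * int q - int p - int q + 1) 1 + monom 1 p + monom 1 q"
proof -
  define V where "V = {0..<int (p * q)}"
  have gt: "p > 1" "q > 1" using pq prime_gt_1_nat by auto
  then have n: "p * q > 1" by (rule less_1_mult)
  have M: "{S. maximal_intersecting (int (p * q)) S} =
      {{x \<in> V. int p dvd x}, {x \<in> V. int q dvd x}}"
    using maximal_intersecting_two_primes[of "int p" "int q"] pq by (simp add: V_def)
  have card: "card {x \<in> V. int p dvd x} = q" "card {x \<in> V. int q dvd x} = p"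
    using card_multiples[of p q] card_multiples[of q p] gt by (auto simp: V_def mult.commute)
  \<comment> \<open>The sizes \<open>q\<close> and \<open>p\<close> differ, so the sum over the two
    stars really has two terms.\<close>
  then have ne: "{x \<in> V. int p dvd x} \<noteq> {x \<in> V. int q dvd x}"
    using pq(3) by auto
  have "coprime p q"
    using pq by (intro primes_coprime) auto
  then have "totient (p * q) = (p - 1) * (q - 1)"
    using pq by (simp add: totient_mult_coprime totient_prime)
  \<comment> \<open>Passing to integers replaces truncated subtraction, so that the product can be
    expanded.\<close>
  then have "int (totient (p * q)) = (int p - 1) * (int q - 1)"
    using gt by (simp add: of_nat_diff)
  then have "int (totient (p * q)) = int p * int q - int p - int q + 1"
    by (simp add: algebra_simps)
  then show ?thesis
    using ne card by (simp only: independent_domination_poly_comaximal[OF n] M) simp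
qed

text \<open>The multiples of \<open>p * q\<close>, \<open>p * r\<close> and \<open>q * r\<close>
  number \<open>r\<close>, \<open>q\<close> and \<open>p\<close>. A common element of two of these
  sets is divisible by all three primes, hence is 0. Counting 0 once and the nonzero multiples
  separately gives 1 + (r - 1) + (q - 1) + (p - 1).\<close>

lemma card_two_of_three_dvd:
  assumes pqr: "prime p" "prime q" "prime r" "p < q" "q < r"
  shows "card {x \<in> {0..<int (p * q * r)}. int p dvd x \<and> int q dvd x \<or>
    int p dvd x \<and> int r dvd x \<or> int q dvd x \<and> int r dvd x} = p + q + r - 2"
proof -
  define V where "V = {0..<int (p * q * r)}"
  define A where "A = (\<lambda>d. {x \<in> V. int d dvd x} - {0})"
  have gt: "p > 1" "q > 1" "r > 1" using pqr prime_gt_1_nat by auto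
  have cop: "coprime p q" "coprime p r" "coprime q r"
    using pqr by (auto intro!: primes_coprime)
  have dvd: "int (a * b) dvd x \<longleftrightarrow> int a dvd x \<and> int b dvd x" if "coprime a b" for a b x
    using that by (auto intro: divides_mult dest: dvd_mult_left dvd_mult_right)
  have zero: "x = 0" if "x \<in> V" "int p dvd x" "int q dvd x" "int r dvd x" for x
  proof -
    have "int (p * q * r) dvd x"
      using that cop dvd[of p q x] dvd[of "p * q" r x] by auto
    then show ?thesis
      using that(1) zdvd_not_zless[of x "int (p * q * r)"] by (force simp: V_def)
  qed
  have "0 \<in> V" using gt by (simp add: V_def)
  have card: "card (A d) = e - 1" if "d * e = p * q * r" for d e
  proof -
    have "d > 0" using that gt by (intro Nat.gr0I) auto
    then have "card {x \<in> V. int d dvd x} = e"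
      using card_multiples[of d e] that by (simp only: V_def)
    moreover have "0 \<in> {x \<in> V. int d dvd x}" using \<open>0 \<in> V\<close> by simp
    ultimately show ?thesis by (simp add: A_def)
  qed
  have c: "card (A (p * q)) = r - 1" "card (A (p * r)) = q - 1" "card (A (q * r)) = p - 1"
    by (intro card; simp)+
  have A: "A (a * b) = {x \<in> V. int a dvd x \<and> int b dvd x} - {0}" if "coprime a b" for a b
    using dvd[OF that] unfolding A_def by auto
  have fin: "finite (A d)" for d
    by (rule finite_subset[of _ V]) (auto simp: A_def V_def)
  have disj: "A (p * q) \<inter> A (p * r) = {}" "(A (p * q) \<union> A (p * r)) \<inter> A (q * r) = {}"
    "0 \<notin> A (p * q) \<union> A (p * r) \<union> A (q * r)"
    using zero by (auto simp only: A[OF cop(1)] A[OF cop(2)] A[OF cop(3)])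
  have "{x \<in> V. int p dvd x \<and> int q dvd x \<or> int p dvd x \<and> int r dvd x \<or>
      int q dvd x \<and> int r dvd x} = insert 0 (A (p * q) \<union> A (p * r) \<union> A (q * r))"
    using \<open>0 \<in> V\<close> by (auto simp only: A[OF cop(1)] A[OF cop(2)] A[OF cop(3)])
  also have "card \<dots> = 1 + (r - 1) + (q - 1) + (p - 1)"
    using disj fin by (simp add: card_Un_disjoint c)
  finally show ?thesis
    using gt by (simp add: V_def)
qed

text \<open>Beyond the classification and the sizes, the four families must be shown pairwise
  distinct, so that the sum over them has four terms.\<close>

lemma independent_domination_poly_comaximal_three_primes:
  assumes pqr: "prime p" "prime q" "prime r" "p < q" "q < r"
  shows "independent_domination_poly (comaximal_graph (residue_ring (int (p * q * r)))) =
    monom (int (totient (p * q * r))) 1 + monom 1 (p + q + r - 2) +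
    monom 1 (p * q) + monom 1 (p * r) + monom 1 (q * r)"
proof -
  define V where "V = {0..<int (p * q * r)}"
  define B where "B = {x \<in> V. int p dvd x \<and> int q dvd x \<or>
    int p dvd x \<and> int r dvd x \<or> int q dvd x \<and> int r dvd x}"
  have gt: "p > 1" "q > 1" "r > 1" using pqr prime_gt_1_nat by auto
  then have n: "p * q * r > 1" by (intro less_1_mult)
  have M: "{S. maximal_intersecting (int (p * q * r)) S} =
      {{x \<in> V. int p dvd x}, {x \<in> V. int q dvd x}, {x \<in> V. int r dvd x}, B}"
    using maximal_intersecting_three_primes[of "int p" "int q" "int r"] pqr
    by (simp add: V_def B_def)
  have cardB: "card B = p + q + r - 2"
    using card_two_of_three_dvd[OF pqr] by (simp only: B_def V_def)
  have "card {x \<in> V. int d dvd x} = e" if "d * e = p * q * r" for d e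
  proof -
    have "d > 0" using that gt by (intro Nat.gr0I) auto
    then show ?thesis
      using card_multiples[of d e] that by (simp only: V_def)
  qed
  then have card: "card {x \<in> V. int p dvd x} = q * r" "card {x \<in> V. int q dvd x} = p * r"
      "card {x \<in> V. int r dvd x} = p * q"
    by simp_all
  \<comment> \<open>The three stars are told apart by their sizes.\<close>
  have "q * r \<noteq> p * r" "q * r \<noteq> p * q" "p * r \<noteq> p * q"
    using pqr gt by auto
  then have ne: "{x \<in> V. int p dvd x} \<noteq> {x \<in> V. int q dvd x}"
      "{x \<in> V. int p dvd x} \<noteq> {x \<in> V. int r dvd x}"
      "{x \<in> V. int q dvd x} \<noteq> {x \<in> V. int r dvd x}"
    using card by metis+
  \<comment> \<open>Sizes cannot separate \<open>B\<close> from the stars: for the primes 3, 7, 13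
    both \<open>p + q + r - 2\<close> and \<open>p * q\<close> equal 21. Instead, the product of the
    two other primes lies in \<open>B\<close> but not in the star of \<open>a\<close>.\<close>
  have neB: "{x \<in> V. int a dvd x} \<noteq> B"
    if "int (b * c) \<in> B" "prime a" "prime b" "prime c" "a \<noteq> b" "a \<noteq> c" for a b c
  proof -
    have "\<not> a dvd b * c"
      using that by (metis prime_dvd_mult_iff primes_dvd_imp_eq)
    then have "\<not> int a dvd int (b * c)"
      by (simp only: int_dvd_int_iff not_False_eq_True)
    then show ?thesis using that(1) by blast
  qed
  have "q * r < p * q * r" "p * r < p * q * r" "p * q < p * q * r"
    using gt by auto
  then have "int (q * r) \<in> V" "int (p * r) \<in> V" "int (p * q) \<in> V"
    by (simp_all only: V_def atLeastLessThan_iff of_nat_less_iff of_nat_0_le_iff)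
  then have "int (q * r) \<in> B" "int (p * r) \<in> B" "int (p * q) \<in> B"
    by (simp_all add: B_def)
  then have neB: "{x \<in> V. int p dvd x} \<noteq> B" "{x \<in> V. int q dvd x} \<noteq> B" "{x \<in> V. int r dvd x} \<noteq> B"
    using neB[of q r p] neB[of p r q] neB[of p q r] pqr by auto
  show ?thesis
    using ne neB by (simp only: independent_domination_poly_comaximal[OF n] M) (simp add: card cardB)
qed

theorem corollary2p3:
  fixes n :: nat
  shows "(\<forall>p::nat. prime p \<and> n = p \<longrightarrow>
            independent_domination_poly (comaximal_graph (residue_ring (int n))) =
              monom (int p) 1) \<and>
         (\<forall>p q::nat. prime p \<and> prime q \<and> p < q \<and> n = p * q \<longrightarrow>
            independent_domination_poly (comaximal_graph (residue_ring (int n))) =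
              monom (int p * int q - int p - int q + 1) 1 + monom 1 p + monom 1 q) \<and>
         (\<forall>p q r::nat. prime p \<and> prime q \<and> prime r \<and> p < q \<and> q < r \<and> n = p * q * r \<longrightarrow>
            independent_domination_poly (comaximal_graph (residue_ring (int n))) =
              monom (int (totient n)) 1 + monom 1 (p + q + r - 2) +
              monom 1 (p * q) + monom 1 (p * r) + monom 1 (q * r))"
  using independent_domination_poly_comaximal_prime
    independent_domination_poly_comaximal_two_primes
    independent_domination_poly_comaximal_three_primes
  by blast

end
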